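(* Let $p \in \mathbb{P}^*=(-\infty,0)\cup(1,\infty]$, $q, r \in (1,\infty)$ and $k \in (0,1)$. Then $$E_{p,q,r^*}(k)K_{p,r,q^*}(k')+K_{p,q,r^*}(k)E_{p,r,q^*}(k')-K_{p,q,r^*}(k)K_{p,r,q^*}(k')=\frac{\pi_{p,q}\,\pi_{s,r}}{4},$$ where $k':=(1-k^q)^{1/r}$ and $s$ is defined by $1/s=1/p-1/q$.
   Context: Conventions: $1/\infty=0$ and $1/0=\infty$. Let $\mathbb{P}^*:=(-\infty,0)\cup(1,\infty]$. For an index $s$, its conjugate $s^*$ is defined by $1/s+1/s^*=1$ (so $\infty^*=1$). For $p\in\mathbb{P}^*$, $q,r\in(1,\infty)$ and $k\in[0,1)$, the generalized complete elliptic integrals are $$K_{p,q,r}(k):=\int_0^1 \frac{dt}{(1-t^q)^{1/p}(1-k^qt^q)^{1/r}},\qquad E_{p,q,r}(k):=\int_0^1 \frac{(1-k^qt^q)^{1/r^*}}{(1-t^q)^{1/p}}\,dt,$$ where for $p=\infty$ the factor $(1-t^q)^{1/p}$ is read as $1$. Thus, for instance, $K_{p,q,r^*}(k)=\int_0^1 (1-t^q)^{-1/p}(1-k^qt^q)^{-1/r^*}dt$ and $E_{p,q,r^*}(k)=\int_0^1 (1-t^q)^{-1/p}(1-k^qt^q)^{1/r}dt$. For $p\in\mathbb{P}^*$ and $q\in(1,\infty)$, $$\pi_{p,q}:=2\int_0^1\frac{dt}{(1-t^q)^{1/p}}=\frac{2}{q}B\left(\frac1q,\frac1{p^*}\right),$$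 where $B$ is the beta function; in particular $\pi_{\infty,q}=2$. *)

theory Defs
  imports "HOL-Analysis.Analysis"
begin

text \<open>
  Only the first index ranges over a set containing infinity, so it is an \<^typ>\<open>ereal\<close>, where
  \<^prop>\<open>1 / \<infinity> = (0 :: ereal)\<close> and \<^prop>\<open>1 / 0 = (\<infinity> :: ereal)\<close>; the other two indices are real.
\<close>

definition P_star :: "ereal set" where
  "P_star = {-\<infinity><..<0} \<union> {1<..}"

definition conj_index :: "real \<Rightarrow> real" where
  "conj_index s = 1 / (1 - 1 / s)"

text \<open>
  For \<open>p = \<infinity>\<close> the exponent \<open>real_of_ereal (1 / p)\<close> is 0, so \<open>(1 - t powr q) powr 0\<close> is 1
  for \<open>0 \<le> t < 1\<close>; the value at the single point \<open>t = 1\<close>, where \<open>0 powr x = 0\<close> and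
  \<open>y / 0 = 0\<close>, does not affect the integrals.
\<close>

definition gen_ellK :: "ereal \<Rightarrow> real \<Rightarrow> real \<Rightarrow> real \<Rightarrow> real" where
  "gen_ellK p q r k =
     integral {0..1} (\<lambda>t. 1 / ((1 - t powr q) powr real_of_ereal (1 / p)
                              * (1 - k powr q * t powr q) powr (1 / r)))"

definition gen_ellE :: "ereal \<Rightarrow> real \<Rightarrow> real \<Rightarrow> real \<Rightarrow> real" where
  "gen_ellE p q r k =
     integral {0..1} (\<lambda>t. (1 - k powr q * t powr q) powr (1 / conj_index r)
                          / (1 - t powr q) powr real_of_ereal (1 / p))"

definition gen_pi :: "ereal \<Rightarrow> real \<Rightarrow> real" where
  "gen_pi p q = 2 * integral {0..1} (\<lambda>t. 1 / (1 - t powr q) powr real_of_ereal (1 / p))"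

end

theory Submission
  imports Defs
begin

text \<open>
  The substitutions \<open>u = t powr q\<close> and \<open>v = t powr r\<close> turn all the integrals into Euler integrals
  with weight \<open>u powr (\<alpha> - 1) * (1 - u) powr (c - 1) * (1 - x * u) powr b\<close>, where \<open>\<alpha> = 1 / q\<close>,
  \<open>\<beta> = 1 / r\<close>, \<open>c = 1 - 1 / p\<close>, \<open>x = k powr q\<close> and \<open>y = k' powr r = 1 - x\<close>. Passing from \<open>K\<close> to \<open>E\<close>
  multiplies the integrand by \<open>1 - x * u\<close> (respectively \<open>1 - y * v\<close>). Hence the left-hand side is,
  up to the factor \<open>\<alpha> * \<beta>\<close>, one double integral over the unit square, of the product of
  \<open>u powr (\<alpha> - 1) * (1 - y * v) powr (\<alpha> - 1)\<close>, \<open>v powr (\<beta> - 1) * (1 - x * u) powr (\<beta> - 1)\<close>,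
  \<open>((1 - u) * (1 - v)) powr (c - 1)\<close> and
  \<open>(1 - x * u) + (1 - y * v) - 1 = 1 - x * u - y * v\<close>.

  The key observation is that the map \<open>X = u * (1 - y * v)\<close>, \<open>Y = v * (1 - x * u)\<close> takes the open
  unit square bijectively to the triangle \<open>X, Y > 0\<close>, \<open>X + Y < 1\<close>, that its Jacobian determinant is
  exactly \<open>1 - x * u - y * v\<close>, and that \<open>1 - X - Y = (1 - u) * (1 - v)\<close>. So the double integral is
  the Dirichlet integral of \<open>X powr (\<alpha> - 1) * Y powr (\<beta> - 1) * (1 - X - Y) powr (c - 1)\<close>, in which
  \<open>x\<close> no longer occurs, and scaling \<open>X\<close> by \<open>1 - Y\<close> splits it into the product of the two beta
  integrals behind \<open>gen_pi p q\<close> and \<open>gen_pi s r\<close>; the exponent \<open>c + \<alpha>\<close> of the second one is where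
  \<open>1 / s = 1 / p - 1 / q\<close> comes from. The resulting identity \<open>elliott_identity\<close> is an integral form
  of Elliott's generalisation of the Legendre relation.

  All of this is done with nonnegative integrals in \<^typ>\<open>ennreal\<close>, where Tonelli's theorem has no
  integrability condition; finiteness enters only in the translation back to the integrals that
  define \<open>K\<close>, \<open>E\<close> and \<open>\<pi>\<close>.
\<close>

section \<open>From the square to the triangle\<close>

text \<open>
  The map \<open>(u, v) \<mapsto> (u * (1 - y * v), v * (1 - x * u))\<close> is decomposed into two
  one-variable substitutions with Tonelli's theorem in between:
  \<open>X = u * (1 - y * v)\<close> for fixed \<open>v\<close>, and then \<open>Y = v * (1 - x * X / (1 - y * v))\<close> for fixed \<open>X\<close>.
  The factors \<open>1 - y * v\<close> and \<open>1 - x * X / (1 - y * v)\<^sup>2\<close> multiply to the Jacobian determinant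
  \<open>1 - x * u - y * v\<close>. The vanishing of \<open>h\<close> off the open triangle absorbs the difference between
  open and closed intervals of integration.
\<close>

lemma triangle_change_of_variables:
  fixes h :: "real \<Rightarrow> real \<Rightarrow> ennreal" and x y :: real
  assumes [measurable]: "case_prod h \<in> borel_measurable borel"
    and supp: "\<And>X Y. \<not> (0 < X \<and> 0 < Y \<and> X + Y < 1) \<Longrightarrow> h X Y = 0"
    and x: "0 < x" and y: "0 < y" and xy: "x + y = 1"
  shows "(\<integral>\<^sup>+v. \<integral>\<^sup>+u. h (u * (1 - y * v)) (v * (1 - x * u)) * ennreal (1 - x * u - y * v)
             * indicator {0..1} u * indicator {0..1} v \<partial>lborel \<partial>lborel)
       = (\<integral>\<^sup>+X. \<integral>\<^sup>+Y. h X Y \<partial>lborel \<partial>lborel)"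
proof -
  have [measurable (raw)]: "(\<lambda>z. h (f z) (g z)) \<in> borel_measurable M"
    if "f \<in> borel_measurable M" "g \<in> borel_measurable M" for f g and M :: "'z measure"
    using measurable_compose[OF measurable_Pair[OF that] assms(1)[unfolded borel_prod[symmetric]]]
    by simp
  \<comment> \<open>the integrand in the intermediate coordinates \<open>(v, X)\<close>\<close>
  define G where "G v X = h X (v * (1 - x * (X / (1 - y * v))))
      * ennreal (1 - x * X / (1 - y * v)\<^sup>2) * indicator {0..1 - y * v} X * indicator {0..1} v"
    for v X
  have [measurable]: "case_prod G \<in> borel_measurable (lborel \<Otimes>\<^sub>M lborel)"
  proof -
    \<comment> \<open>an indicator of an interval whose endpoint depends on \<open>v\<close> becomes a conditional, for which
      joint measurability is routine\<close>
    have "case_prod G = (\<lambda>z. h (snd z) (fst z * (1 - x * (snd z / (1 - y * fst z))))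
        * ennreal (1 - x * snd z / (1 - y * fst z)\<^sup>2)
        * (if 0 \<le> snd z \<and> snd z \<le> 1 - y * fst z then 1 else 0)
        * (if 0 \<le> fst z \<and> fst z \<le> 1 then 1 else 0))"
      by (auto simp: G_def fun_eq_iff indicator_def)
    also have "\<dots> \<in> borel_measurable (lborel \<Otimes>\<^sub>M lborel)"
      by measurable
    finally show ?thesis .
  qed
  have "(\<integral>\<^sup>+u. h (u * (1 - y * v)) (v * (1 - x * u)) * ennreal (1 - x * u - y * v)
             * indicator {0..1} u * indicator {0..1} v \<partial>lborel) = (\<integral>\<^sup>+X. G v X \<partial>lborel)"
    (is "?L = _") for v
  proof (cases "v \<in> {0..1}")
    case v: True
    define m where "m = 1 - y * v"
    have "y * v \<le> y" using v y by (auto simp: mult_left_le)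
    then have m: "0 < m" using x xy by (simp add: m_def)
    define f where "f X = h X (v * (1 - x * (X / m))) * ennreal (1 - x * X / m\<^sup>2)" for X
    have [measurable]: "f \<in> borel_measurable borel" unfolding f_def by measurable
    have "(\<integral>\<^sup>+X. f X * indicator {(\<lambda>u. u * m) 0..(\<lambda>u. u * m) 1} X \<partial>lborel)
        = (\<integral>\<^sup>+u. f (u * m) * ennreal m * indicator {0..1} u \<partial>lborel)"
      by (rule nn_integral_substitution_aux)
         (use m in \<open>auto intro!: derivative_eq_intros\<close>)
    also have "\<dots> = ?L"
    proof (rule nn_integral_cong)
      fix u :: real
      have "ennreal (1 - x * (u * m) / m\<^sup>2) * ennreal m = ennreal (1 - x * u - y * v)"
      proof -
        have "(1 - x * (u * m) / m\<^sup>2) * m = m - x * u"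
          using m by (simp add: field_simps power2_eq_square)
        then have e: "(1 - x * (u * m) / m\<^sup>2) * m = 1 - x * u - y * v"
          by (simp add: m_def)
        show ?thesis
          using m by (simp add: e[symmetric] ennreal_mult'')
      qed
      then show "f (u * m) * ennreal m * indicator {0..1} u =
          h (u * (1 - y * v)) (v * (1 - x * u)) * ennreal (1 - x * u - y * v)
             * indicator {0..1} u * indicator {0..1} v"
        using v m by (simp add: f_def m_def mult.assoc)
    qed
    also have "(\<integral>\<^sup>+X. f X * indicator {(\<lambda>u. u * m) 0..(\<lambda>u. u * m) 1} X \<partial>lborel)
        = (\<integral>\<^sup>+X. G v X \<partial>lborel)"
      using v by (simp add: f_def G_def m_def)
    finally show ?thesis by simp
  qed (simp add: G_def)
  then have "(\<integral>\<^sup>+v. \<integral>\<^sup>+u. h (u * (1 - y * v)) (v * (1 - x * u)) * ennreal (1 - x * u - y * v)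
             * indicator {0..1} u * indicator {0..1} v \<partial>lborel \<partial>lborel)
      = (\<integral>\<^sup>+v. \<integral>\<^sup>+X. G v X \<partial>lborel \<partial>lborel)"
    by simp
  also have "\<dots> = (\<integral>\<^sup>+X. \<integral>\<^sup>+v. G v X \<partial>lborel \<partial>lborel)"
    by (rule lborel_pair.Fubini'[symmetric]) measurable
  also have "\<dots> = (\<integral>\<^sup>+X. \<integral>\<^sup>+Y. h X Y \<partial>lborel \<partial>lborel)"
  proof (rule nn_integral_cong)
    fix X :: real
    show "(\<integral>\<^sup>+v. G v X \<partial>lborel) = (\<integral>\<^sup>+Y. h X Y \<partial>lborel)"
    proof (cases "0 < X \<and> X < 1")
      case False
      then have "h X Y = 0" for Y by (intro supp) auto
      then show ?thesis by (simp add: G_def)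
    next
      case X: True
      \<comment> \<open>\<open>v\<close> ranges over \<open>[0, 1]\<close> subject to \<open>X \<le> 1 - y * v\<close>; whichever bound is active at \<open>b\<close>,
        \<open>g\<close> takes the value \<open>1 - X\<close> there\<close>
      define b where "b = min 1 ((1 - X) / y)"
      define g where "g v = v * (1 - x * (X / (1 - y * v)))" for v
      have b: "0 < b" "b \<le> 1" "b * y \<le> 1 - X"
        using X y by (auto simp: b_def min_def field_simps)
      have bd: "X \<le> 1 - y * v \<and> x \<le> 1 - y * v" if "v \<in> {0..b}" for v
      proof -
        have "y * v \<le> y * b" "y * b \<le> y * 1" using that b y by (auto intro: mult_left_mono)
        then show ?thesis using b xy by (simp add: mult.commute)
      qed
      have g0: "g 0 = 0" by (simp add: g_def)
      have gb: "g b = 1 - X"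
      proof (cases "(1 - X) / y \<le> 1")
        case True
        then have "b * y = 1 - X" using y by (simp add: b_def)
        then have "1 - y * b = X" by (simp add: mult.commute)
        then have "g b = b * (1 - x)" using X by (simp add: g_def)
        also have "\<dots> = b * y" using xy by (simp flip: xy)
        finally show ?thesis using \<open>b * y = 1 - X\<close> by simp
      next
        case False
        then have "b = 1" by (simp add: b_def)
        moreover have "1 - y = x" using xy by simp
        ultimately show ?thesis using x by (simp add: g_def)
      qed
      have "(\<integral>\<^sup>+Y. h X Y * indicator {g 0..g b} Y \<partial>lborel)
          = (\<integral>\<^sup>+v. h X (g v) * ennreal (1 - x * X / (1 - y * v)\<^sup>2) * indicator {0..b} v \<partial>lborel)"
      proof (rule nn_integral_substitution_aux)
        fix v assume v: "v \<in> {0..b}"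
        have nz: "1 - y * v > 0" using bd[OF v] X by linarith
        show "(g has_real_derivative 1 - x * X / (1 - y * v)\<^sup>2) (at v)"
        proof -
          define m where "m = 1 - y * v"
          have m: "0 < m" using nz by (simp add: m_def)
          have "(g has_real_derivative (1 - x * (X / m)) - v * (x * (X * y / m\<^sup>2))) (at v)"
            unfolding g_def m_def
            by (auto intro!: derivative_eq_intros simp: power2_eq_square) (use nz in auto)
          also have "(1 - x * (X / m)) - v * (x * (X * y / m\<^sup>2)) = 1 - x * X * (m + y * v) / m\<^sup>2"
            using m by (simp add: field_simps power2_eq_square)
          also have "m + y * v = 1" by (simp add: m_def)
          finally show ?thesis by (simp add: m_def)
        qed
        \<comment> \<open>both \<open>x\<close> and \<open>X\<close> are at most \<open>1 - y * v\<close>, so \<open>g\<close> is monotone\<close>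
        have "x * X \<le> (1 - y * v) * (1 - y * v)"
          using bd[OF v] X x nz by (intro mult_mono) auto
        then show "0 \<le> 1 - x * X / (1 - y * v)\<^sup>2"
          using nz by (simp add: power2_eq_square)
      next
        have "1 - y * v \<noteq> 0" if "v \<in> {0..b}" for v using bd[OF that] X by linarith
        then show "continuous_on {0..b} (\<lambda>v. 1 - x * X / (1 - y * v)\<^sup>2)"
          by (intro continuous_intros) auto
      qed (use b in auto)
      also have "\<dots> = (\<integral>\<^sup>+v. G v X \<partial>lborel)"
      proof (rule nn_integral_cong)
        fix v :: real
        have "v \<in> {0..b} \<longleftrightarrow> X \<in> {0..1 - y * v} \<and> v \<in> {0..1}"
          using X y by (auto simp: b_def field_simps)
        then have "(indicator {0..b} v :: ennreal) = indicator {0..1 - y * v} X * indicator {0..1} v"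
          by (simp add: indicator_def)
        then show "h X (g v) * ennreal (1 - x * X / (1 - y * v)\<^sup>2) * indicator {0..b} v = G v X"
          by (simp add: G_def g_def mult.assoc)
      qed
      also have "(\<integral>\<^sup>+Y. h X Y * indicator {g 0..g b} Y \<partial>lborel) = (\<integral>\<^sup>+Y. h X Y \<partial>lborel)"
      proof (rule nn_integral_cong)
        fix Y :: real
        show "h X Y * indicator {g 0..g b} Y = h X Y"
          using supp[of X Y] by (cases "Y \<in> {0..1 - X}") (auto simp: g0 gb)
      qed
      finally show ?thesis by simp
    qed
  qed
  finally show ?thesis .
qed


section \<open>The Dirichlet integral and the Euler integral\<close>

text \<open>
  Euler's integral for \<open>Beta \<alpha> c\<close> times the hypergeometric function with parameters \<open>- b\<close>, \<open>\<alpha>\<close>;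
  \<open>\<alpha> + c\<close> at \<open>x\<close>. The beta integral is the case \<open>b = 0\<close>, \<open>x = 0\<close>.
\<close>

definition euler_integral :: "real \<Rightarrow> real \<Rightarrow> real \<Rightarrow> real \<Rightarrow> ennreal" where
  "euler_integral \<alpha> c b x = (\<integral>\<^sup>+u. ennreal (u powr (\<alpha> - 1) * (1 - u) powr (c - 1) * (1 - x * u) powr b)
      * indicator {0..1} u \<partial>lborel)"

definition dirichlet_density :: "real \<Rightarrow> real \<Rightarrow> real \<Rightarrow> real \<Rightarrow> real \<Rightarrow> ennreal" where
  "dirichlet_density \<alpha> \<beta> c X Y = (if 0 < X \<and> 0 < Y \<and> X + Y < 1
      then ennreal (X powr (\<alpha> - 1) * Y powr (\<beta> - 1) * (1 - X - Y) powr (c - 1)) else 0)"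

lemma borel_measurable_dirichlet_density:
  "case_prod (dirichlet_density \<alpha> \<beta> c) \<in> borel_measurable borel"
  unfolding dirichlet_density_def borel_prod[symmetric] by measurable

text \<open>
  For fixed \<open>Y\<close>, the substitution \<open>X = (1 - Y) * w\<close> gives \<open>1 - X - Y = (1 - Y) * (1 - w)\<close>, so the
  variables \<open>w\<close> and \<open>Y\<close> separate and all powers of \<open>1 - Y\<close> collect in the beta integral in \<open>Y\<close>.
\<close>

lemma nn_integral_dirichlet_density:
  "(\<integral>\<^sup>+X. \<integral>\<^sup>+Y. dirichlet_density \<alpha> \<beta> c X Y \<partial>lborel \<partial>lborel)
     = euler_integral \<alpha> c 0 0 * euler_integral \<beta> (c + \<alpha>) 0 0"
proof -
  have [measurable]: "case_prod (dirichlet_density \<alpha> \<beta> c) \<in> borel_measurable (lborel \<Otimes>\<^sub>M lborel)"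
    using borel_measurable_dirichlet_density by (simp add: lborel_prod)
  have "(\<integral>\<^sup>+X. \<integral>\<^sup>+Y. dirichlet_density \<alpha> \<beta> c X Y \<partial>lborel \<partial>lborel)
      = (\<integral>\<^sup>+Y. \<integral>\<^sup>+X. dirichlet_density \<alpha> \<beta> c X Y \<partial>lborel \<partial>lborel)"
    by (rule lborel_pair.Fubini'[symmetric]) measurable
  also have "\<dots> = (\<integral>\<^sup>+Y. ennreal (Y powr (\<beta> - 1) * (1 - Y) powr (c + \<alpha> - 1)) * indicator {0..1} Y
       * euler_integral \<alpha> c 0 0 \<partial>lborel)"
  proof (rule nn_integral_cong)
    fix Y :: real
    show "(\<integral>\<^sup>+X. dirichlet_density \<alpha> \<beta> c X Y \<partial>lborel)
        = ennreal (Y powr (\<beta> - 1) * (1 - Y) powr (c + \<alpha> - 1)) * indicator {0..1} Y * euler_integral \<alpha> c 0 0"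
    proof (cases "0 < Y \<and> Y < 1")
      case False
      then have "dirichlet_density \<alpha> \<beta> c X Y = 0" for X
        by (auto simp: dirichlet_density_def)
      moreover have "Y \<notin> {0..1} \<or> Y = 0 \<or> Y = 1" using False by auto
      ultimately show ?thesis by auto
    next
      case Y: True
      define m where "m = 1 - Y"
      have m: "0 < m" using Y by (simp add: m_def)
      have [measurable]: "(\<lambda>X. dirichlet_density \<alpha> \<beta> c X Y) \<in> borel_measurable borel"
        unfolding dirichlet_density_def by measurable
      have "(\<integral>\<^sup>+X. dirichlet_density \<alpha> \<beta> c X Y \<partial>lborel)
          = (\<integral>\<^sup>+X. dirichlet_density \<alpha> \<beta> c X Y * indicator {(\<lambda>w. w * m) 0..(\<lambda>w. w * m) 1} X \<partial>lborel)"
        by (intro nn_integral_cong) (auto simp: dirichlet_density_def m_def indicator_def)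
      also have "\<dots> = (\<integral>\<^sup>+w. dirichlet_density \<alpha> \<beta> c (w * m) Y * ennreal m * indicator {0..1} w \<partial>lborel)"
        by (rule nn_integral_substitution_aux)
           (use m in \<open>auto intro!: derivative_eq_intros\<close>)
      also have "\<dots> = (\<integral>\<^sup>+w. ennreal (Y powr (\<beta> - 1) * (1 - Y) powr (c + \<alpha> - 1)) *
          (ennreal (w powr (\<alpha> - 1) * (1 - w) powr (c - 1) * (1 - 0 * w) powr 0) * indicator {0..1} w) \<partial>lborel)"
      proof (rule nn_integral_cong)
        fix w :: real
        show "dirichlet_density \<alpha> \<beta> c (w * m) Y * ennreal m * indicator {0..1} w
          = ennreal (Y powr (\<beta> - 1) * (1 - Y) powr (c + \<alpha> - 1)) *
          (ennreal (w powr (\<alpha> - 1) * (1 - w) powr (c - 1) * (1 - 0 * w) powr 0) * indicator {0..1} w)"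
        proof (cases "0 < w \<and> w < 1")
          case False
          then have "w \<notin> {0..1} \<or> w = 0 \<or> w = 1" by auto
          then show ?thesis by (auto simp: dirichlet_density_def m_def)
        next
          case w: True
          have "w * m < m" using w m by simp
          then have in_tri: "w * m + Y < 1" by (simp add: m_def)
          have e: "1 - w * m - Y = (1 - w) * m" by (simp add: m_def algebra_simps)
          have "(w * m) powr (\<alpha> - 1) * Y powr (\<beta> - 1) * (1 - w * m - Y) powr (c - 1) * m
            = Y powr (\<beta> - 1) * (m powr (\<alpha> - 1) * m powr (c - 1) * m powr 1)
              * (w powr (\<alpha> - 1) * (1 - w) powr (c - 1))"
            unfolding e using w m by (simp add: powr_mult)
          also have "m powr (\<alpha> - 1) * m powr (c - 1) * m powr 1 = m powr (c + \<alpha> - 1)"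
            by (simp only: powr_add[symmetric]) (simp add: algebra_simps)
          finally show ?thesis
            using w m Y in_tri
            by (simp add: dirichlet_density_def m_def flip: ennreal_mult'')
        qed
      qed
      also have "\<dots> = ennreal (Y powr (\<beta> - 1) * (1 - Y) powr (c + \<alpha> - 1)) * euler_integral \<alpha> c 0 0"
        unfolding euler_integral_def by (rule nn_integral_cmult) measurable
      finally show ?thesis using Y by simp
    qed
  qed
  also have "\<dots> = euler_integral \<beta> (c + \<alpha>) 0 0 * euler_integral \<alpha> c 0 0"
    unfolding euler_integral_def by (subst nn_integral_multc) (auto intro!: arg_cong2[of _ _ _ _ "(*)"] nn_integral_cong simp: indicator_def)
  finally show ?thesis by (simp add: mult.commute)
qed

section \<open>The identity of Elliott type\<close>

text \<open>
  The four products are double integrals over the square whose integrands are \<open>P * (1 - x * u)\<close>,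
  \<open>P * (1 - y * v)\<close>, \<open>P\<close> and, for the beta integrals, \<open>P * (1 - x * u - y * v)\<close> after the change of
  variables, with one common factor \<open>P\<close>; the identity holds already between the integrands. The
  product that is subtracted in the Legendre relation stands on the right-hand side here, since
  subtraction of extended nonnegative reals is truncated and does not cancel at infinity.
\<close>

lemma elliott_identity:
  fixes x y :: real
  assumes x: "0 < x" and y: "0 < y" and xy: "x + y = 1"
  shows "euler_integral \<alpha> c \<beta> x * euler_integral \<beta> c (\<alpha> - 1) y + euler_integral \<alpha> c (\<beta> - 1) x * euler_integral \<beta> c \<alpha> y
       = euler_integral \<alpha> c (\<beta> - 1) x * euler_integral \<beta> c (\<alpha> - 1) y
         + euler_integral \<alpha> c 0 0 * euler_integral \<beta> (c + \<alpha>) 0 0"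
proof -
  define w where "w a b z u = ennreal (u powr (a - 1) * (1 - u) powr (c - 1) * (1 - z * u) powr b)
      * indicator {0..1} u" for a b z u :: real
  have [measurable]: "w a b z \<in> borel_measurable borel" for a b z
    unfolding w_def by measurable
  have euler: "euler_integral a c b z = (\<integral>\<^sup>+u. w a b z u \<partial>lborel)" for a b z
    by (simp add: euler_integral_def w_def)
  have prod: "euler_integral \<alpha> c b x * euler_integral \<beta> c d y
      = (\<integral>\<^sup>+v. \<integral>\<^sup>+u. w \<alpha> b x u * w \<beta> d y v \<partial>lborel \<partial>lborel)" for b d
    unfolding euler by (simp add: nn_integral_cmult nn_integral_multc)
  have "euler_integral \<alpha> c \<beta> x * euler_integral \<beta> c (\<alpha> - 1) y + euler_integral \<alpha> c (\<beta> - 1) x * euler_integral \<beta> c \<alpha> y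
     = (\<integral>\<^sup>+v. \<integral>\<^sup>+u. w \<alpha> \<beta> x u * w \<beta> (\<alpha> - 1) y v + w \<alpha> (\<beta> - 1) x u * w \<beta> \<alpha> y v \<partial>lborel \<partial>lborel)"
    by (simp add: prod nn_integral_add)
  also have "\<dots> = (\<integral>\<^sup>+v. \<integral>\<^sup>+u. w \<alpha> (\<beta> - 1) x u * w \<beta> (\<alpha> - 1) y v
      + dirichlet_density \<alpha> \<beta> c (u * (1 - y * v)) (v * (1 - x * u)) * ennreal (1 - x * u - y * v)
             * indicator {0..1} u * indicator {0..1} v \<partial>lborel \<partial>lborel)"
  proof (intro nn_integral_cong)
    fix u v :: real
    show "w \<alpha> \<beta> x u * w \<beta> (\<alpha> - 1) y v + w \<alpha> (\<beta> - 1) x u * w \<beta> \<alpha> y v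
      = w \<alpha> (\<beta> - 1) x u * w \<beta> (\<alpha> - 1) y v
      + dirichlet_density \<alpha> \<beta> c (u * (1 - y * v)) (v * (1 - x * u)) * ennreal (1 - x * u - y * v)
             * indicator {0..1} u * indicator {0..1} v"
    \<comment> \<open>off the open square all terms vanish: outside by the indicators, on the boundary because
      \<open>0 powr a = 0\<close> and the boundary is mapped into the boundary of the triangle\<close>
    proof (cases "0 < u \<and> u < 1 \<and> 0 < v \<and> v < 1")
      case False
      have "1 - x = y" "1 - y = x" using xy by auto
      then have "u \<notin> {0..1} \<or> v \<notin> {0..1} \<or> u = 0 \<or> v = 0 \<or> u = 1 \<or> v = 1"
        using False by auto
      moreover have "dirichlet_density \<alpha> \<beta> c (u * (1 - y * v)) (v * (1 - x * u)) = 0"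
        if "u = 0 \<or> v = 0 \<or> u = 1 \<or> v = 1"
        using that \<open>1 - x = y\<close> \<open>1 - y = x\<close> by (auto simp: dirichlet_density_def mult.commute)
      moreover have "w a b z u * w a' b' z' v = 0" if "u = 0 \<or> v = 0 \<or> u = 1 \<or> v = 1"
        for a b z a' b' z'
        using that by (auto simp: w_def)
      ultimately show ?thesis by (auto simp: w_def)
    next
      case uv: True
      have "x * u < x" "y * v < y" using uv x y by auto
      then have pos: "0 < 1 - x * u" "0 < 1 - y * v" "0 < 1 - x * u - y * v" using x y xy by linarith+
      define P where "P = u powr (\<alpha> - 1) * (1 - u) powr (c - 1) * (1 - x * u) powr (\<beta> - 1)
        * (v powr (\<beta> - 1) * (1 - v) powr (c - 1) * (1 - y * v) powr (\<alpha> - 1))"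
      have P: "0 \<le> P" by (simp add: P_def)
      have succ: "z powr b = z powr (b - 1) * z" if "0 < z" for z b :: real
        using that by (simp add: powr_diff)
      have y': "y = 1 - x" using xy by simp
      have e: "1 - u * (1 - y * v) - v * (1 - x * u) = (1 - u) * (1 - v)"
        unfolding y' by (simp add: algebra_simps)
      have tri: "u * (1 - y * v) + v * (1 - x * u) < 1"
        using e uv mult_pos_pos[of "1 - u" "1 - v"] by linarith
      have "dirichlet_density \<alpha> \<beta> c (u * (1 - y * v)) (v * (1 - x * u)) = ennreal P"
        using uv pos tri unfolding dirichlet_density_def e P_def
        by (simp add: powr_mult mult_ac)
      moreover have wprod: "w \<alpha> b x u * w \<beta> d y v
        = ennreal (u powr (\<alpha> - 1) * (1 - u) powr (c - 1) * (1 - x * u) powr b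
            * (v powr (\<beta> - 1) * (1 - v) powr (c - 1) * (1 - y * v) powr d))" for b d
        using uv by (simp add: w_def flip: ennreal_mult'')
      have "w \<alpha> (\<beta> - 1) x u * w \<beta> (\<alpha> - 1) y v = ennreal P"
        by (simp add: wprod P_def)
      moreover have "w \<alpha> \<beta> x u * w \<beta> (\<alpha> - 1) y v = ennreal (P * (1 - x * u))"
        unfolding wprod P_def by (subst succ[OF pos(1), of \<beta>]) (simp add: mult_ac)
      moreover have "w \<alpha> (\<beta> - 1) x u * w \<beta> \<alpha> y v = ennreal (P * (1 - y * v))"
        unfolding wprod P_def by (subst succ[OF pos(2), of \<alpha>]) (simp add: mult_ac)
      moreover have "ennreal (P * (1 - x * u)) + ennreal (P * (1 - y * v))
          = ennreal P + ennreal P * ennreal (1 - x * u - y * v)"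
      proof -
        have "ennreal (P * (1 - x * u)) + ennreal (P * (1 - y * v))
            = ennreal (P * (1 - x * u) + P * (1 - y * v))"
          using P pos by simp
        also have "P * (1 - x * u) + P * (1 - y * v) = P + P * (1 - x * u - y * v)"
          by (simp add: algebra_simps)
        also have "ennreal \<dots> = ennreal P + ennreal P * ennreal (1 - x * u - y * v)"
          using P pos by (simp add: ennreal_mult)
        finally show ?thesis .
      qed
      ultimately show ?thesis
        using uv by simp
    qed
  qed
  also have "\<dots> = euler_integral \<alpha> c (\<beta> - 1) x * euler_integral \<beta> c (\<alpha> - 1) y
     + (\<integral>\<^sup>+v. \<integral>\<^sup>+u. dirichlet_density \<alpha> \<beta> c (u * (1 - y * v)) (v * (1 - x * u)) * ennreal (1 - x * u - y * v)
             * indicator {0..1} u * indicator {0..1} v \<partial>lborel \<partial>lborel)"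
    unfolding prod dirichlet_density_def by (simp add: nn_integral_add)
  also have "(\<integral>\<^sup>+v. \<integral>\<^sup>+u. dirichlet_density \<alpha> \<beta> c (u * (1 - y * v)) (v * (1 - x * u)) * ennreal (1 - x * u - y * v)
             * indicator {0..1} u * indicator {0..1} v \<partial>lborel \<partial>lborel)
     = (\<integral>\<^sup>+X. \<integral>\<^sup>+Y. dirichlet_density \<alpha> \<beta> c X Y \<partial>lborel \<partial>lborel)"
    by (rule triangle_change_of_variables[OF borel_measurable_dirichlet_density _ x y xy])
       (auto simp: dirichlet_density_def)
  finally show ?thesis by (simp add: nn_integral_dirichlet_density)
qed


section \<open>Euler integrals as integrals of the elliptic type\<close>

text \<open>
  On \<open>[0, 1]\<close> the last factor stays between the positive numbers \<open>1\<close> and \<open>(1 - x) powr b\<close>, so the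
  integral is dominated by a multiple of the beta integral.
\<close>

lemma euler_integral_finite:
  assumes "0 < \<alpha>" "0 < c" "0 \<le> x" "x < 1"
  shows "euler_integral \<alpha> c b x < \<infinity>"
proof -
  define M where "M = max 1 ((1 - x) powr b)"
  have "euler_integral \<alpha> c b x
      \<le> (\<integral>\<^sup>+u. ennreal M * (ennreal (u powr (\<alpha> - 1) * (1 - u) powr (c - 1)) * indicator {0..1} u) \<partial>lborel)"
    unfolding euler_integral_def
  proof (rule nn_integral_mono)
    fix u :: real
    have "(1 - x * u) powr b \<le> M" if u: "u \<in> {0..1}"
    proof -
      have xu: "0 \<le> x * u" "x * u \<le> x" using u assms by (auto simp: mult_left_le)
      show ?thesis
      proof (cases "0 \<le> b")
        case True
        then have "(1 - x * u) powr b \<le> 1 powr b"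
          using xu assms by (intro powr_mono2) auto
        then show ?thesis by (simp add: M_def)
      next
        case False
        then have "(1 - x * u) powr b \<le> (1 - x) powr b"
          using xu assms by (intro powr_mono2') auto
        then show ?thesis by (simp add: M_def)
      qed
    qed
    then have "u powr (\<alpha> - 1) * (1 - u) powr (c - 1) * (1 - x * u) powr b
        \<le> M * (u powr (\<alpha> - 1) * (1 - u) powr (c - 1))" if "u \<in> {0..1}"
      using that by (subst mult.commute[of M]) (intro mult_left_mono, auto)
    moreover have "0 \<le> M" by (simp add: M_def)
    ultimately show "ennreal (u powr (\<alpha> - 1) * (1 - u) powr (c - 1) * (1 - x * u) powr b) * indicator {0..1} u
        \<le> ennreal M * (ennreal (u powr (\<alpha> - 1) * (1 - u) powr (c - 1)) * indicator {0..1} u)"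
      by (auto simp: indicator_def ennreal_leI simp flip: ennreal_mult')
  qed
  also have "\<dots> = ennreal M *
      (\<integral>\<^sup>+u. ennreal (u powr (\<alpha> - 1) * (1 - u) powr (c - 1)) * indicator {0..1} u \<partial>lborel)"
    by (rule nn_integral_cmult) measurable
  also have "\<dots> = ennreal M * ennreal (Beta \<alpha> c)"
    using nn_integral_has_integral_lebesgue'[OF _ has_integral_Beta_real[of \<alpha> c]] assms by simp
  also have "\<dots> < \<infinity>" by (simp add: ennreal_mult_less_top)
  finally show ?thesis .
qed

text \<open>
  This is the substitution \<open>u = t powr q\<close>. It is made on the open interval, because at \<open>t = 0\<close> the
  two integrands differ: \<open>0 powr (1 / q - 1)\<close> is 0.
\<close>

lemma euler_integral_eq_integral:
  assumes "0 < c" "0 \<le> x" "x < 1" "1 < q"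
  shows "euler_integral (1 / q) c b x
    = ennreal (q * integral {0..1} (\<lambda>t. (1 - t powr q) powr (c - 1) * (1 - x * t powr q) powr b))"
proof -
  let ?f = "\<lambda>u. u powr (1 / q - 1) * (1 - u) powr (c - 1) * (1 - x * u) powr b"
  let ?h = "\<lambda>t. (1 - t powr q) powr (c - 1) * (1 - x * t powr q) powr b"
  have q: "0 < q" using assms by simp
  obtain r where r: "euler_integral (1 / q) c b x = ennreal r" "0 \<le> r"
    using euler_integral_finite[of "1 / q" c x b] assms
    by (cases "euler_integral (1 / q) c b x" rule: ennreal_cases) auto
  have "((\<lambda>u. ?f u * indicator {0..1} u) has_integral r) UNIV"
  proof (rule nn_integral_has_integral)
    have "(\<integral>\<^sup>+u. ennreal (?f u * indicator {0..1} u) \<partial>lborel) = euler_integral (1 / q) c b x"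
      unfolding euler_integral_def by (intro nn_integral_cong) (simp add: indicator_def)
    then show "(\<integral>\<^sup>+u. ennreal (?f u * indicator {0..1} u) \<partial>lborel) = ennreal r"
      by (simp add: r)
  qed (use r in auto)
  then have "((\<lambda>u. if u \<in> {0..1} then ?f u else 0) has_integral r) UNIV"
    by (rule has_integral_eq[rotated]) (simp add: indicator_def)
  then have "(?f has_integral r) {0..1}"
    by (simp only: has_integral_restrict_UNIV)
  then have I: "(?f has_integral r) {0<..<1}"
    by (simp add: has_integral_Icc_iff_Ioo)
  have img: "(\<lambda>t. t powr q) ` {0<..<1} = {0<..<1}"
  proof (intro equalityI subsetI)
    fix u :: real assume u: "u \<in> {0<..<1}"
    then have "u = (u powr (1 / q)) powr q" using q by (simp add: powr_powr)
    moreover have "u powr (1 / q) \<in> {0<..<1}"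
      using u q powr_less_mono2[of "1 / q" u 1] by auto
    ultimately show "u \<in> (\<lambda>t. t powr q) ` {0<..<1}" by blast
  next
    fix u assume "u \<in> (\<lambda>t. t powr q) ` {0<..<1}"
    then obtain t where "u = t powr q" "0 < t" "t < 1" by auto
    then show "u \<in> {0<..<1}" using q powr_less_mono2[of q t 1] by simp
  qed
  have deriv: "((\<lambda>t. t powr q) has_real_derivative q * t powr (q - 1)) (at t within {0<..<1})"
    if "t \<in> {0<..<1}" for t
    by (rule has_field_derivative_at_within, rule has_real_derivative_powr) (use that in auto)
  have inj: "inj_on (\<lambda>t. t powr q) {0<..<1}"
  proof (rule inj_onI)
    fix t t' :: real assume "t \<in> {0<..<1}" "t' \<in> {0<..<1}" "t powr q = t' powr q"
    then show "t = t'"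
      using q powr_less_mono2[of q t t'] powr_less_mono2[of q t' t]
      by (cases t t' rule: linorder_cases) auto
  qed
  note has_absolute_integral_change_of_variables_1'[where S = "{0<..<1}" and f = ?f and b = r
      and g = "\<lambda>t. t powr q" and g' = "\<lambda>t. q * t powr (q - 1)", OF _ deriv inj, unfolded img]
  moreover have "?f absolutely_integrable_on {0<..<1}"
    using I by (intro nonnegative_absolutely_integrable_1) (auto simp: has_integral_iff)
  moreover have "integral {0<..<1} ?f = r"
    using I by (rule integral_unique)
  ultimately have "integral {0<..<1} (\<lambda>t. \<bar>q * t powr (q - 1)\<bar> * ?f (t powr q)) = r"
    by simp
  then have "r = integral {0<..<1} (\<lambda>t. \<bar>q * t powr (q - 1)\<bar> * ?f (t powr q))" by simp
  also have "\<dots> = integral {0<..<1} (\<lambda>t. q * ?h t)"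
  proof (rule integral_cong)
    fix t :: real assume t: "t \<in> {0<..<1}"
    have "t powr (q - 1) * (t powr q) powr (1 / q - 1) = t powr (q - 1 + q * (1 / q - 1))"
      by (simp only: powr_powr powr_add)
    also have "q - 1 + q * (1 / q - 1) = 0" using q by (simp add: field_simps)
    finally have "t powr (q - 1) * (t powr q) powr (1 / q - 1) = 1" using t by simp
    moreover have "\<bar>q * t powr (q - 1)\<bar> * ?f (t powr q)
        = q * (t powr (q - 1) * (t powr q) powr (1 / q - 1)) * ?h t"
      using q by (simp add: abs_mult)
    ultimately show "\<bar>q * t powr (q - 1)\<bar> * ?f (t powr q) = q * ?h t" by simp
  qed
  also have "\<dots> = q * integral {0..1} ?h"
    by (simp add: integral_open_interval_real)
  finally show ?thesis using r by simp
qed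

section \<open>The Legendre relation for generalized elliptic integrals\<close>

theorem theorem1p1:
  fixes p s :: ereal and q r k k' :: real
  assumes "p \<in> P_star"
    and "1 < q" and "1 < r"
    and "0 < k" and "k < 1"
    and "k' = (1 - k powr q) powr (1 / r)"
    and "1 / s = 1 / p - 1 / ereal q"
  shows "gen_ellE p q (conj_index r) k * gen_ellK p r (conj_index q) k'
       + gen_ellK p q (conj_index r) k * gen_ellE p r (conj_index q) k'
       - gen_ellK p q (conj_index r) k * gen_ellK p r (conj_index q) k'
       = gen_pi p q * gen_pi s r / 4"
proof -
  \<comment> \<open>all six integrals of the theorem are of this form\<close>
  define I where "I n c x b
    = integral {0..1} (\<lambda>t. (1 - t powr n) powr (c - 1) * (1 - x * t powr n) powr b)"
    for n c x b :: real
  define c where "c = 1 - real_of_ereal (1 / p)"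
  define x y where "x = k powr q" and "y = 1 - x"
  obtain a where a: "1 / p = ereal a" "a < 1"
  proof (cases p)
    case (real z)
    then have "1 / p = ereal (1 / z)" "1 / z < 1"
      using assms(1) by (auto simp: P_star_def one_ereal_def divide_less_eq)
    then show ?thesis by (rule that)
  next
    case PInf
    then have "1 / p = ereal 0" by simp
    then show ?thesis by (rule that) simp
  qed (use assms(1) in \<open>simp add: P_star_def\<close>)
  have c: "0 < c" and ca: "- real_of_ereal (1 / p) = c - 1" using a by (auto simp: c_def)
  have cs: "- real_of_ereal (1 / s) = c + 1 / q - 1"
    using assms(2,7) a by (simp add: c_def one_ereal_def)
  have x: "0 < x" "x < 1"
    using assms(2,4,5) powr_less_mono2[of q k 1] by (auto simp: x_def)
  have y: "0 < y" "y < 1" "x + y = 1" using x by (auto simp: y_def)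
  have ky: "k' powr r = y" using assms(3,6) x by (simp add: powr_powr y_def x_def)
  have conj: "1 / conj_index n = 1 - 1 / n" "1 / conj_index (conj_index n) = 1 / n" if "1 < n" for n
    using that by (auto simp: conj_index_def)
  have K: "gen_ellK p n (conj_index m) l = I n c (l powr n) (1 / m - 1)" if "1 < m" for n m l
  proof -
    have m: "1 / m - 1 = - (1 - 1 / m)" by simp
    show ?thesis
      unfolding gen_ellK_def I_def conj(1)[OF that] ca[symmetric] m powr_minus_divide by simp
  qed
  have E: "gen_ellE p n (conj_index m) l = I n c (l powr n) (1 / m)" if "1 < m" for n m l
    unfolding gen_ellE_def I_def conj(2)[OF that] ca[symmetric] powr_minus_divide by simp
  have pi_p: "gen_pi p q = 2 * I q c 0 0"
    unfolding gen_pi_def I_def ca[symmetric] powr_minus_divide by simp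
  have pi_s: "gen_pi s r = 2 * I r (c + 1 / q) 0 0"
    unfolding gen_pi_def I_def cs[symmetric] powr_minus_divide by simp
  have nonneg: "0 \<le> I n d z b" for n d z b
  proof (cases "(\<lambda>t. (1 - t powr n) powr (d - 1) * (1 - z * t powr n) powr b) integrable_on {0..1}")
    case True
    then show ?thesis unfolding I_def by (rule integral_nonneg) simp
  qed (simp add: I_def not_integrable_integral)
  have ident: "I q c x (1 / r) * I r c y (1 / q - 1) + I q c x (1 / r - 1) * I r c y (1 / q)
      = I q c x (1 / r - 1) * I r c y (1 / q - 1) + I q c 0 0 * I r (c + 1 / q) 0 0"
  proof -
    have euler: "euler_integral (1 / n) d b z = ennreal (n * I n d z b)"
      if "0 < d" "0 \<le> z" "z < 1" "1 < n" for n d b z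
      unfolding I_def by (rule euler_integral_eq_integral[OF that])
    have cq: "0 < c + 1 / q" using c assms(2) by (simp add: add_pos_pos)
    define A1 A2 A3 where "A1 = I q c x (1 / r)" and "A2 = I q c x (1 / r - 1)" and "A3 = I q c 0 0"
    define B1 B2 B3 where "B1 = I r c y (1 / q)" and "B2 = I r c y (1 / q - 1)"
      and "B3 = I r (c + 1 / q) 0 0"
    note AB = A1_def A2_def A3_def B1_def B2_def B3_def
    have pos: "0 \<le> A1" "0 \<le> A2" "0 \<le> A3" "0 \<le> B1" "0 \<le> B2" "0 \<le> B3" "0 < q" "0 < r"
      using assms(2,3) by (auto simp: AB nonneg)
    have vals: "euler_integral (1 / q) c (1 / r) x = ennreal (q * A1)"
      "euler_integral (1 / q) c (1 / r - 1) x = ennreal (q * A2)"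
      "euler_integral (1 / q) c 0 0 = ennreal (q * A3)"
      "euler_integral (1 / r) c (1 / q) y = ennreal (r * B1)"
      "euler_integral (1 / r) c (1 / q - 1) y = ennreal (r * B2)"
      "euler_integral (1 / r) (c + 1 / q) 0 0 = ennreal (r * B3)"
      unfolding AB using c cq x y assms(2,3) by (auto intro!: euler)
    \<comment> \<open>each Euler integral contributes the factor \<open>q\<close> or \<open>r\<close> of the substitution; all four products
      carry \<open>q * r\<close>, which cancels\<close>
    have "ennreal (q * A1 * (r * B2) + q * A2 * (r * B1)) = ennreal (q * A2 * (r * B2) + q * A3 * (r * B3))"
      using elliott_identity[OF x(1) y(1) y(3), of "1 / q" c "1 / r"] pos
      unfolding vals by (simp add: ennreal_mult ennreal_plus)
    then have "q * A1 * (r * B2) + q * A2 * (r * B1) = q * A2 * (r * B2) + q * A3 * (r * B3)"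
      using pos by (subst (asm) ennreal_inj) auto
    then have "(q * r) * (A1 * B2 + A2 * B1) = (q * r) * (A2 * B2 + A3 * B3)"
      by (simp only: distrib_left mult_ac)
    then have "A1 * B2 + A2 * B1 = A2 * B2 + A3 * B3"
      using pos by simp
    then show ?thesis unfolding AB .
  qed
  show ?thesis
    unfolding K[OF assms(3)] K[OF assms(2)] E[OF assms(3)] E[OF assms(2)] pi_p pi_s ky
    using ident by (simp add: x_def)
qed

end
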